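(* Let $K$ be a field, let $Q$ be the quiver of Dynkin type $E_7$ with vertices $1,\dots,7$ and arrows $a_1:2\to 1$, $a_2:3\to 2$, $a_3:4\to 3$, $a_4:5\to 4$, $a_5:6\to 5$, $a_6:3\to 7$, and let $A=KQ$ be the path algebra of $Q$. Then $A$ has no slope function of the form $\mu=\frac{\theta}{\dim}$ that defines a total stability condition. That is, there is no linear function $\theta:K_0(A)\to\mathbb{R}$ such that, with $\mu(M)=\theta(M)/\dim_K M$ for nonzero finite-dimensional $A$-modules $M$, every indecomposable $A$-module is $\mu$-stable.
   Context: Modules are finite-dimensional right $A$-modules, identified with finite-dimensional representations of $Q$ over $K$: a vector space $V_i$ for each vertex $i$ and a linear map $V_i\to V_j$ for each arrow $i\to j$. Submodules correspond to subrepresentations. $K_0(A)$ is the Grothendieck group of $A$, identified with $\mathbb{Z}^7$ via dimension vectors $[\dim V_1,\dots,\dim V_7]$. A linear function $\theta:K_0(A)\to\mathbb{R}$ is thus given by real numbers $x_1,\dots,x_7$ via $\theta([y_1,\dots,y_7])=\sum_{i=1}^7 x_iy_i$, and $\theta(M)$ means $\theta$ applied to the class (dimension vector) of $M$. The function $\dim$ sends a module $M$ to its vector space dimension $\dim_K M=\sum_{i=1}^7 \dim V_i$. A slope function for $A$ is a quotient $\mu=\theta/\kappa$ of linear functions $\theta,\kappa:K_0(A)\to\mathbb{R}$ with $\kappa(M)>0$ for all nonzero modules $M$; here $\kappa=\dim$. A nonzero $A$-module $M$ is called $\mu$-stable if $\mu(N)<\mu(M)$ for all nonzero proper submodules $N$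 of $M$. A slope function $\mu$ defines a total stability condition if every indecomposable $A$-module is $\mu$-stable. *)

theory Defs
  imports Complex_Main "HOL-Library.Function_Algebras" "HOL-Analysis.Finite_Cartesian_Product"
begin

text \<open>
  A quiver has the types \<open>'v\<close> and \<open>'a\<close> as its sets of vertices and arrows.
\<close>

record ('v, 'a) quiver =
  source :: "'a \<Rightarrow> 'v"
  target :: "'a \<Rightarrow> 'v"

text \<open>
  The vector spaces of a representation are subspaces of one ambient vector space \<open>'b\<close>.
  The value of \<^term>\<open>arrow_map M a\<close> outside the space at the source of \<open>a\<close> is irrelevant.
\<close>

record ('v, 'a, 'b) quiver_rep =
  space_at :: "'v \<Rightarrow> 'b set"
  arrow_map :: "'a \<Rightarrow> 'b \<Rightarrow> 'b"

locale quiver_reps = vector_space scale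
  for scale :: "'k::field \<Rightarrow> 'b::ab_group_add \<Rightarrow> 'b"
begin

definition fin_dim_subspace :: "'b set \<Rightarrow> bool" where
  "fin_dim_subspace V \<longleftrightarrow> subspace V \<and> (\<exists>B. finite B \<and> span B = V)"

definition linear_between :: "'b set \<Rightarrow> 'b set \<Rightarrow> ('b \<Rightarrow> 'b) \<Rightarrow> bool" where
  "linear_between V W f \<longleftrightarrow>
     (\<forall>x\<in>V. f x \<in> W) \<and>
     (\<forall>x\<in>V. \<forall>y\<in>V. f (x + y) = f x + f y) \<and>
     (\<forall>c. \<forall>x\<in>V. f (scale c x) = scale c (f x))"

definition fd_representation ::
    "('v, 'a) quiver \<Rightarrow> ('v, 'a, 'b) quiver_rep \<Rightarrow> bool" where
  "fd_representation Q M \<longleftrightarrow>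
     (\<forall>i. fin_dim_subspace (space_at M i)) \<and>
     (\<forall>a. linear_between (space_at M (source Q a)) (space_at M (target Q a)) (arrow_map M a))"

definition nonzero_rep :: "('v, 'a, 'b) quiver_rep \<Rightarrow> bool" where
  "nonzero_rep M \<longleftrightarrow> (\<exists>i. space_at M i \<noteq> {0})"

definition subrep ::
    "('v, 'a) quiver \<Rightarrow> ('v, 'a, 'b) quiver_rep \<Rightarrow> ('v, 'a, 'b) quiver_rep \<Rightarrow> bool" where
  "subrep Q N M \<longleftrightarrow>
     fd_representation Q N \<and>
     (\<forall>i. space_at N i \<subseteq> space_at M i) \<and>
     (\<forall>a. \<forall>x\<in>space_at N (source Q a). arrow_map N a x = arrow_map M a x)"

definition indecomposable ::
    "('v, 'a) quiver \<Rightarrow> ('v, 'a, 'b) quiver_rep \<Rightarrow> bool" where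
  "indecomposable Q M \<longleftrightarrow>
     fd_representation Q M \<and> nonzero_rep M \<and>
     \<not> (\<exists>N L. subrep Q N M \<and> subrep Q L M \<and> nonzero_rep N \<and> nonzero_rep L \<and>
          (\<forall>i. space_at M i = {x + y |x y. x \<in> space_at N i \<and> y \<in> space_at L i} \<and>
               space_at N i \<inter> space_at L i = {0}))"

definition stable ::
    "('v, 'a) quiver \<Rightarrow> (('v, 'a, 'b) quiver_rep \<Rightarrow> real) \<Rightarrow> ('v, 'a, 'b) quiver_rep \<Rightarrow> bool" where
  "stable Q \<mu> M \<longleftrightarrow>
     fd_representation Q M \<and> nonzero_rep M \<and>
     (\<forall>N. subrep Q N M \<and> nonzero_rep N \<and> space_at N \<noteq> space_at M \<longrightarrow> \<mu> N < \<mu> M)"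

definition total_stability ::
    "('v, 'a) quiver \<Rightarrow> (('v, 'a, 'b) quiver_rep \<Rightarrow> real) \<Rightarrow> bool" where
  "total_stability Q \<mu> \<longleftrightarrow> (\<forall>M. indecomposable Q M \<longrightarrow> stable Q \<mu> M)"

definition dim_vector :: "('v::finite, 'a, 'b) quiver_rep \<Rightarrow> int ^ 'v" where
  "dim_vector M = (\<chi> i. int (dim (space_at M i)))"

definition total_dim :: "('v::finite, 'a, 'b) quiver_rep \<Rightarrow> nat" where
  "total_dim M = (\<Sum>i\<in>UNIV. dim (space_at M i))"

end

text \<open>
  As ambient space we take the infinite-dimensional space of sequences over the field.
  Every finite-dimensional vector space embeds into it, so every finite-dimensional
  representation is isomorphic to one inside it.
\<close>

definition seq_scale :: "'k::field \<Rightarrow> (nat \<Rightarrow> 'k) \<Rightarrow> nat \<Rightarrow> 'k" where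
  "seq_scale c f = (\<lambda>n. c * f n)"

interpretation seq: quiver_reps seq_scale
  by unfold_locales (auto simp: seq_scale_def fun_eq_iff algebra_simps)

datatype e7_vertex = V1 | V2 | V3 | V4 | V5 | V6 | V7

datatype e7_arrow = A1 | A2 | A3 | A4 | A5 | A6

lemma UNIV_e7_vertex: "UNIV = {V1, V2, V3, V4, V5, V6, V7}"
  using e7_vertex.exhaust by blast

instance e7_vertex :: finite
  by standard (simp add: UNIV_e7_vertex)

fun e7_source :: "e7_arrow \<Rightarrow> e7_vertex" where
  "e7_source A1 = V2"
| "e7_source A2 = V3"
| "e7_source A3 = V4"
| "e7_source A4 = V5"
| "e7_source A5 = V6"
| "e7_source A6 = V3"

fun e7_target :: "e7_arrow \<Rightarrow> e7_vertex" where
  "e7_target A1 = V1"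
| "e7_target A2 = V2"
| "e7_target A3 = V3"
| "e7_target A4 = V4"
| "e7_target A5 = V5"
| "e7_target A6 = V7"

definition E7 :: "(e7_vertex, e7_arrow) quiver" where
  "E7 = \<lparr>source = e7_source, target = e7_target\<rparr>"

type_synonym 'k e7_rep = "(e7_vertex, e7_arrow, nat \<Rightarrow> 'k) quiver_rep"

end

theory Submission imports Defs begin

text \<open>
  Five pairs of an indecomposable representation \<open>M\<close> and a subrepresentation \<open>N\<close>, with all
  entries of the dimension vectors at most \<open>2\<close>, already impose contradictory conditions.
  Written as \<open>[y\<^sub>1, \<dots>, y\<^sub>7]\<close>, the dimension vectors of \<open>M\<close> and \<open>N\<close> are

    \<^item> \<open>[0,0,1,1,0,0,0]\<close> and \<open>[0,0,1,0,0,0,0]\<close>,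
    \<^item> \<open>[0,1,2,1,0,0,1]\<close> and \<open>[0,1,1,0,0,0,0]\<close>,
    \<^item> \<open>[0,1,2,2,1,0,1]\<close> and \<open>[0,1,1,1,0,0,0]\<close>,
    \<^item> \<open>[1,2,2,1,1,1,1]\<close> and \<open>[1,1,1,1,1,1,1]\<close>,
    \<^item> \<open>[1,1,2,2,2,1,1]\<close> and \<open>[0,0,1,1,1,0,1]\<close>.

  If \<open>\<theta>\<close> has the coordinates \<open>x\<^sub>1, \<dots>, x\<^sub>7\<close>, the stability conditions \<open>\<mu>(N) < \<mu>(M)\<close> become, after
  clearing denominators,

    \<^item> \<open>0 < x\<^sub>4 - x\<^sub>3\<close>,
    \<^item> \<open>0 < - 3x\<^sub>2 - x\<^sub>3 + 2x\<^sub>4 + 2x\<^sub>7\<close>,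
    \<^item> \<open>0 < - 4x\<^sub>2 - x\<^sub>3 - x\<^sub>4 + 3x\<^sub>5 + 3x\<^sub>7\<close>,
    \<^item> \<open>0 < - 2x\<^sub>1 + 5x\<^sub>2 + 5x\<^sub>3 - 2x\<^sub>4 - 2x\<^sub>5 - 2x\<^sub>6 - 2x\<^sub>7\<close>,
    \<^item> \<open>0 < 2x\<^sub>1 + 2x\<^sub>2 - x\<^sub>3 - x\<^sub>4 - x\<^sub>5 + 2x\<^sub>6 - 3x\<^sub>7\<close>,

  and twice the first right-hand side plus the four others is \<open>0\<close>.

  The first \<open>M\<close> is a string of two lines. The other four all come from the
  indecomposable representation of type \<open>D\<^sub>4\<close> that consists of a plane with one distinguished line
  and two projections onto lines. The plane sits at the branch vertex \<open>3\<close>, the distinguished line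
  on the arm \<open>4, 5, 6\<close>, and the quotient lines on the arms \<open>2, 1\<close> and \<open>7\<close>. In a direct sum
  decomposition, one summand contains the distinguished line, which neither projection kills; so
  the other summand is killed by both projections and therefore vanishes
  (\<open>plane_dichotomy\<close>). All other maps are injective towards the branch vertex or surjective away
  from it, so that a summand which vanishes at the branch vertex vanishes everywhere
  (\<open>e7_rep_indecomposable\<close>). This works over every field.
\<close>

section \<open>Direct sum decompositions\<close>

context quiver_reps
begin

definition decomposes ::
    "('v, 'a) quiver \<Rightarrow> ('v, 'a, 'b) quiver_rep \<Rightarrow> ('v, 'a, 'b) quiver_rep \<Rightarrow>
     ('v, 'a, 'b) quiver_rep \<Rightarrow> bool" where
  "decomposes Q M N L \<longleftrightarrow> subrep Q N M \<and> subrep Q L M \<and>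
     (\<forall>i. space_at M i = {x + y |x y. x \<in> space_at N i \<and> y \<in> space_at L i} \<and>
          space_at N i \<inter> space_at L i = {0})"

lemma decomposes_commute: "decomposes Q M N L \<Longrightarrow> decomposes Q M L N"
proof -
  have "{x + y |x y. x \<in> A \<and> y \<in> B} = {x + y |x y. x \<in> B \<and> y \<in> A}" for A B :: "'b set"
    by (intro Collect_cong) (metis add.commute)
  then show "decomposes Q M N L \<Longrightarrow> decomposes Q M L N"
    unfolding decomposes_def by (simp add: Int_commute)
qed

lemma decomposes_subrep: "decomposes Q M N L \<Longrightarrow> subrep Q N M"
  by (simp add: decomposes_def)

lemma subrep_subspace: "subrep Q N M \<Longrightarrow> subspace (space_at N i)"
  by (simp add: subrep_def fd_representation_def fin_dim_subspace_def)

lemma subrep_subset: "subrep Q N M \<Longrightarrow> space_at N i \<subseteq> space_at M i"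
  by (simp add: subrep_def)

lemma subrep_arrow:
  assumes "subrep Q N M" "x \<in> space_at N (source Q a)"
  shows "arrow_map M a x \<in> space_at N (target Q a)"
proof -
  have "arrow_map N a x \<in> space_at N (target Q a)"
    using assms unfolding subrep_def fd_representation_def linear_between_def by blast
  moreover have "arrow_map N a x = arrow_map M a x"
    using assms unfolding subrep_def by blast
  ultimately show ?thesis by simp
qed

lemma decomposes_complement:
  assumes "decomposes Q M N L" "space_at L i = {0}"
  shows "space_at N i = space_at M i"
  using assms by (auto simp: decomposes_def)

lemma decomposes_disjoint:
  assumes "decomposes Q M N L" "x \<in> space_at N i" "x \<in> space_at L i"
  shows "x = 0"
  using assms by (auto simp: decomposes_def)

text \<open>A one-dimensional space has no proper nonzero subspaces.\<close>

lemma line_dichotomy: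
  assumes dec: "decomposes Q M N L" and line: "space_at M i = span {v}"
  shows "space_at N i = {0} \<or> space_at L i = {0}"
proof -
  have full: "v \<in> W" if W: "subspace W" "W \<subseteq> span {v}" "W \<noteq> {0}" for W
  proof -
    obtain x where x: "x \<in> W" "x \<noteq> 0"
      using W subspace_0 by blast
    then obtain c where c: "x = scale c v"
      using W(2) by (auto simp: span_singleton)
    with x have "c \<noteq> 0" by auto
    then have "v = scale (inverse c) x"
      using c by simp
    then show ?thesis
      using subspace_scale[OF W(1) x(1)] by simp
  qed
  have N: "subrep Q N M" and L: "subrep Q L M"
    using dec by (auto simp: decomposes_def)
  show ?thesis
  proof (rule ccontr)
    assume nz: "\<not> ?thesis"
    then have "v \<in> space_at N i" "v \<in> space_at L i"
      using full subrep_subspace[OF N] subrep_subspace[OF L] subrep_subset[OF N, of i]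
        subrep_subset[OF L, of i] line by auto
    then have "v = 0"
      by (rule decomposes_disjoint[OF dec])
    then show False
      using nz subrep_subset[OF N, of i] subspace_0[OF subrep_subspace[OF N, of i]] line
      by auto
  qed
qed

lemma summand_vanishes_at_source:
  assumes "decomposes Q M N L" "space_at L (target Q a) = {0}"
    and "\<And>x. x \<in> space_at M (source Q a) \<Longrightarrow> arrow_map M a x = 0 \<Longrightarrow> x = 0"
  shows "space_at L (source Q a) = {0}"
proof -
  have L: "subrep Q L M"
    using assms(1) by (simp add: decomposes_def)
  then show ?thesis
    using assms(2,3) subrep_arrow[OF L, of _ a] subrep_subset[OF L]
      subspace_0[OF subrep_subspace[OF L]] by blast
qed

text \<open>
  Where \<open>L\<close> vanishes, \<open>N\<close> is all of \<open>M\<close>; a surjective arrow map carries this to the target, and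
  there \<open>L\<close> has to vanish as well.
\<close>

lemma summand_vanishes_at_target:
  assumes dec: "decomposes Q M N L" and zero: "space_at L (source Q a) = {0}"
    and surj: "space_at M (target Q a) \<subseteq> arrow_map M a ` space_at M (source Q a)"
  shows "space_at L (target Q a) = {0}"
proof -
  have N: "subrep Q N M" and L: "subrep Q L M"
    using dec by (auto simp: decomposes_def)
  have "space_at M (target Q a) \<subseteq> space_at N (target Q a)"
    using surj subrep_arrow[OF N] decomposes_complement[OF dec zero] by auto
  then show ?thesis
    using subrep_subset[OF L] decomposes_disjoint[OF dec]
      subspace_0[OF subrep_subspace[OF L]] by blast
qed

lemma indecomposableI:
  assumes "fd_representation Q M" "nonzero_rep M"
    and "\<And>N L. decomposes Q M N L \<Longrightarrow> nonzero_rep N \<Longrightarrow> nonzero_rep L \<Longrightarrow> False"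
  shows "indecomposable Q M"
  using assms unfolding indecomposable_def decomposes_def by blast

end

section \<open>Lines and a plane in the space of sequences\<close>

definition unit_seq :: "nat \<Rightarrow> nat \<Rightarrow> 'k::field" where
  "unit_seq n = (\<lambda>k. if k = n then 1 else 0)"

definition coord_part :: "nat \<Rightarrow> (nat \<Rightarrow> 'k::field) \<Rightarrow> nat \<Rightarrow> 'k" where
  "coord_part n x = seq_scale (x n) (unit_seq n)"

definition coord_line :: "nat \<Rightarrow> (nat \<Rightarrow> 'k::field) set" where
  "coord_line n = seq.span {unit_seq n}"

definition diagonal :: "(nat \<Rightarrow> 'k::field) set" where
  "diagonal = seq.span {unit_seq 0 + unit_seq 1}"

definition plane :: "(nat \<Rightarrow> 'k::field) set" where
  "plane = seq.span {unit_seq 0, unit_seq 1}"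

lemma coord_part_apply: "coord_part n x k = (if k = n then x n else 0)"
  by (simp add: coord_part_def seq_scale_def unit_seq_def)

lemma coord_part_eq_0: "coord_part n x = 0 \<longleftrightarrow> x n = 0"
  by (auto simp: coord_part_apply fun_eq_iff)

lemma coord_part_zero [simp]: "coord_part n 0 = 0"
  by (simp add: coord_part_eq_0)

lemma mem_coord_line: "x \<in> coord_line n \<longleftrightarrow> (\<forall>k. k \<noteq> n \<longrightarrow> x k = 0)"
proof -
  have "x \<in> coord_line n \<longleftrightarrow> (\<exists>c. x = seq_scale c (unit_seq n))"
    by (auto simp: coord_line_def seq.span_singleton)
  also have "\<dots> \<longleftrightarrow> (\<forall>k. k \<noteq> n \<longrightarrow> x k = 0)"
    by (auto simp: seq_scale_def unit_seq_def fun_eq_iff intro!: exI[of _ "x n"])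
  finally show ?thesis .
qed

lemma mem_diagonal: "x \<in> diagonal \<longleftrightarrow> x 0 = x 1 \<and> (\<forall>k\<ge>2. x k = 0)"
proof -
  have "x = seq_scale (x 0) (unit_seq 0 + unit_seq 1)" if "x 0 = x 1" "\<forall>k\<ge>2. x k = 0"
  proof
    fix k :: nat
    consider "k = 0" | "k = 1" | "k \<ge> 2" by linarith
    then show "x k = seq_scale (x 0) (unit_seq 0 + unit_seq 1) k"
      using that by cases (simp_all add: seq_scale_def unit_seq_def)
  qed
  moreover have "x \<in> diagonal \<longleftrightarrow> (\<exists>c. x = seq_scale c (unit_seq 0 + unit_seq 1))"
    by (auto simp: diagonal_def seq.span_singleton)
  ultimately show ?thesis
    by (auto simp: seq_scale_def unit_seq_def)
qed

lemma mem_plane: "x \<in> plane \<longleftrightarrow> (\<forall>k\<ge>2. x k = 0)"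
proof -
  have "x - seq_scale (x 0) (unit_seq 0) = seq_scale (x 1) (unit_seq 1)" if "\<forall>k\<ge>2. x k = 0"
  proof
    fix k :: nat
    consider "k = 0" | "k = 1" | "k \<ge> 2" by linarith
    then show "(x - seq_scale (x 0) (unit_seq 0)) k = seq_scale (x 1) (unit_seq 1) k"
      using that by cases (simp_all add: seq_scale_def unit_seq_def)
  qed
  moreover have "x \<in> plane \<longleftrightarrow> (\<exists>c d. x - seq_scale c (unit_seq 0) = seq_scale d (unit_seq 1))"
    by (auto simp: plane_def seq.span_insert seq.span_singleton)
  moreover have "x k = 0"
    if "x - seq_scale c (unit_seq 0) = seq_scale d (unit_seq 1)" "k \<ge> 2" for c d k
    using fun_cong[OF that(1), of k] that(2) by (simp add: seq_scale_def unit_seq_def)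
  ultimately show ?thesis
    by blast
qed

lemmas mem_spaces = mem_coord_line mem_diagonal mem_plane

lemma unit_seq_nonzero: "unit_seq n \<noteq> (0 :: nat \<Rightarrow> 'k::field)"
  by (auto simp: unit_seq_def fun_eq_iff)

lemma unit_seq_sum_nonzero: "unit_seq 0 + unit_seq 1 \<noteq> (0 :: nat \<Rightarrow> 'k::field)"
  by (auto simp: unit_seq_def fun_eq_iff intro!: exI[of _ 0])

lemma spaces_distinct:
  "coord_line n \<noteq> {0::nat \<Rightarrow> 'k::field}" "diagonal \<noteq> {0::nat \<Rightarrow> 'k}" "plane \<noteq> {0::nat \<Rightarrow> 'k}"
  "coord_line n \<noteq> (plane :: (nat \<Rightarrow> 'k) set)" "diagonal \<noteq> (plane :: (nat \<Rightarrow> 'k) set)"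
proof -
  have "unit_seq n \<in> (coord_line n :: (nat \<Rightarrow> 'k) set)"
    by (simp add: mem_coord_line unit_seq_def)
  then show "coord_line n \<noteq> {0::nat \<Rightarrow> 'k}"
    using unit_seq_nonzero by blast
  have "unit_seq 0 + unit_seq 1 \<in> (diagonal :: (nat \<Rightarrow> 'k) set)"
    by (simp add: mem_diagonal unit_seq_def)
  then show "diagonal \<noteq> {0::nat \<Rightarrow> 'k}"
    using unit_seq_sum_nonzero by blast
  have plane: "unit_seq 0 \<in> (plane :: (nat \<Rightarrow> 'k) set)" "unit_seq 1 \<in> (plane :: (nat \<Rightarrow> 'k) set)"
    by (simp_all add: mem_plane unit_seq_def)
  then show "plane \<noteq> {0::nat \<Rightarrow> 'k}"
    using unit_seq_nonzero by blast
  have "(unit_seq (if n = 0 then 1 else 0) :: nat \<Rightarrow> 'k) \<notin> coord_line n"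
    by (simp add: mem_coord_line unit_seq_def)
  moreover have "unit_seq (if n = 0 then 1 else 0) \<in> (plane :: (nat \<Rightarrow> 'k) set)"
    using plane by simp
  ultimately show "coord_line n \<noteq> (plane :: (nat \<Rightarrow> 'k) set)"
    by blast
  have "(unit_seq 0 :: nat \<Rightarrow> 'k) \<notin> diagonal"
    by (simp add: mem_diagonal unit_seq_def)
  with plane show "diagonal \<noteq> (plane :: (nat \<Rightarrow> 'k) set)"
    by blast
qed

lemma fin_dim_span: "finite B \<Longrightarrow> seq.fin_dim_subspace (seq.span B)"
  by (auto simp: seq.fin_dim_subspace_def)

lemma fin_dim_spaces:
  "seq.fin_dim_subspace {0}" "seq.fin_dim_subspace (coord_line n)"
  "seq.fin_dim_subspace diagonal" "seq.fin_dim_subspace plane"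
  using fin_dim_span[of "{}"] by (simp_all add: coord_line_def diagonal_def plane_def fin_dim_span)

lemma dim_line: "v \<noteq> 0 \<Longrightarrow> seq.dim (seq.span {v}) = 1"
  by (simp add: seq.dim_eq_card_independent seq.independent_empty seq.dependent_single)

lemma dim_spaces:
  "seq.dim ({0} :: (nat \<Rightarrow> 'k::field) set) = 0"
  "seq.dim (coord_line n :: (nat \<Rightarrow> 'k) set) = 1"
  "seq.dim (diagonal :: (nat \<Rightarrow> 'k) set) = 1"
  "seq.dim (plane :: (nat \<Rightarrow> 'k) set) = 2"
proof -
  show "seq.dim ({0} :: (nat \<Rightarrow> 'k) set) = 0"
    using seq.dim_span_eq_card_independent[OF seq.independent_empty] by simp
  show "seq.dim (coord_line n :: (nat \<Rightarrow> 'k) set) = 1"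
    unfolding coord_line_def by (rule dim_line[OF unit_seq_nonzero])
  show "seq.dim (diagonal :: (nat \<Rightarrow> 'k) set) = 1"
    unfolding diagonal_def by (rule dim_line[OF unit_seq_sum_nonzero])
  have notin: "(unit_seq 0 :: nat \<Rightarrow> 'k) \<notin> seq.span {unit_seq 1}"
    by (simp add: mem_coord_line flip: coord_line_def) (simp add: unit_seq_def)
  then have independent: "seq.independent {unit_seq 0, unit_seq 1 :: nat \<Rightarrow> 'k}"
    using unit_seq_nonzero
    by (intro seq.independent_insertI seq.independent_empty) (simp_all del: One_nat_def)
  have "card {unit_seq 0, unit_seq 1 :: nat \<Rightarrow> 'k} = 2"
    using notin seq.span_base[of "unit_seq 1 :: nat \<Rightarrow> 'k" "{unit_seq 1}"]
    by (metis card_2_iff singletonI)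
  then show "seq.dim (plane :: (nat \<Rightarrow> 'k) set) = 2"
    unfolding plane_def seq.dim_span_eq_card_independent[OF independent] .
qed

section \<open>Representations built from a plane, a line and two projections\<close>

text \<open>
  The spaces at \<open>V3\<close>, \<dots>, \<open>V6\<close> form a chain of subspaces with inclusions as maps. The maps \<open>g\<close> at
  \<^const>\<open>A1\<close> and \<open>h\<close> at \<^const>\<open>A2\<close> stay parameters because the projection to the first quotient
  line takes place between \<open>V3\<close> and \<open>V2\<close> in some cases and between \<open>V2\<close> and \<open>V1\<close> in another, and
  \<open>g\<close> has to be zero if the space at \<open>V1\<close> is zero and the one at \<open>V2\<close> is not.
\<close>

definition e7_rep ::
  "((nat \<Rightarrow> 'k) \<Rightarrow> nat \<Rightarrow> 'k) \<Rightarrow> ((nat \<Rightarrow> 'k) \<Rightarrow> nat \<Rightarrow> 'k) \<Rightarrow>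
   (nat \<Rightarrow> 'k) set \<Rightarrow> (nat \<Rightarrow> 'k) set \<Rightarrow> (nat \<Rightarrow> 'k) set \<Rightarrow> (nat \<Rightarrow> 'k) set \<Rightarrow>
   (nat \<Rightarrow> 'k) set \<Rightarrow> (nat \<Rightarrow> 'k) set \<Rightarrow> (nat \<Rightarrow> 'k) set \<Rightarrow> 'k::field e7_rep" where
  "e7_rep g h S1 S2 S3 S4 S5 S6 S7 =
     \<lparr>space_at = case_e7_vertex S1 S2 S3 S4 S5 S6 S7,
      arrow_map = case_e7_arrow g h id id id (coord_part 1)\<rparr>"

lemma all_e7_vertex: "(\<forall>i. P i) \<longleftrightarrow> P V1 \<and> P V2 \<and> P V3 \<and> P V4 \<and> P V5 \<and> P V6 \<and> P V7"
  using e7_vertex.induct[of P] by blast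

lemma all_e7_arrow: "(\<forall>a. P a) \<longleftrightarrow> P A1 \<and> P A2 \<and> P A3 \<and> P A4 \<and> P A5 \<and> P A6"
  using e7_arrow.induct[of P] by blast

lemma E7_simps [simp]: "source E7 = e7_source" "target E7 = e7_target"
  by (simp_all add: E7_def)

lemma linear_between_coord_part:
  "seq.linear_between V W (coord_part n) \<longleftrightarrow> coord_part n ` V \<subseteq> W"
  by (auto simp: seq.linear_between_def coord_part_def seq_scale_def fun_eq_iff algebra_simps)

lemma linear_between_zero: "0 \<in> W \<Longrightarrow> seq.linear_between V W (\<lambda>_. 0)"
  by (auto simp: seq.linear_between_def seq_scale_def fun_eq_iff)

lemma linear_between_id: "seq.linear_between V W id \<longleftrightarrow> V \<subseteq> W"
  by (auto simp: seq.linear_between_def)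

lemma nonzero_e7_rep: "S3 \<noteq> {0} \<Longrightarrow> seq.nonzero_rep (e7_rep g h S1 S2 S3 S4 S5 S6 S7)"
  unfolding seq.nonzero_rep_def by (rule exI[of _ V3]) (simp add: e7_rep_def)

lemma subrep_e7_rep:
  assumes "seq.fd_representation E7 (e7_rep g h T1 T2 T3 T4 T5 T6 T7)"
    and "T1 \<subseteq> S1" "T2 \<subseteq> S2" "T3 \<subseteq> S3" "T4 \<subseteq> S4" "T5 \<subseteq> S5" "T6 \<subseteq> S6" "T7 \<subseteq> S7"
  shows "seq.subrep E7 (e7_rep g h T1 T2 T3 T4 T5 T6 T7) (e7_rep g h S1 S2 S3 S4 S5 S6 S7)"
  using assms by (auto simp: seq.subrep_def e7_rep_def all_e7_vertex)

text \<open>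
  In each of the representations used here one of the two summands vanishes at the branch vertex,
  and then it vanishes everywhere: along the inclusions \<^const>\<open>A3\<close>, \<^const>\<open>A4\<close>,
  \<^const>\<open>A5\<close> because they point towards the branch vertex, along the other three arrows because
  they are surjective and point away from it.
\<close>

lemma e7_rep_indecomposable:
  assumes fd: "seq.fd_representation E7 (e7_rep g h S1 S2 S3 S4 S5 S6 S7)"
    and S3: "S3 \<noteq> {0}"
    and surj: "S1 \<subseteq> g ` S2" "S2 \<subseteq> h ` S3" "S7 \<subseteq> coord_part 1 ` S3"
    and branch: "\<And>N L. seq.decomposes E7 (e7_rep g h S1 S2 S3 S4 S5 S6 S7) N L \<Longrightarrow>
                   space_at N V3 = {0} \<or> space_at L V3 = {0}"
  shows "seq.indecomposable E7 (e7_rep g h S1 S2 S3 S4 S5 S6 S7)"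
proof (rule seq.indecomposableI[OF fd])
  let ?M = "e7_rep g h S1 S2 S3 S4 S5 S6 S7"
  show "seq.nonzero_rep ?M"
    using S3 by (rule nonzero_e7_rep)
  fix N L assume dec: "seq.decomposes E7 ?M N L"
    and nz: "seq.nonzero_rep N" "seq.nonzero_rep L"
  have zero: "\<not> seq.nonzero_rep L"
    if dec: "seq.decomposes E7 ?M N L" and 3: "space_at L V3 = {0}" for N L
  proof -
    note source = seq.summand_vanishes_at_source[OF dec]
    note target = seq.summand_vanishes_at_target[OF dec]
    have 4: "space_at L V4 = {0}"
      using source[of A3] 3 by (simp add: e7_rep_def)
    have 5: "space_at L V5 = {0}"
      using source[of A4] 4 by (simp add: e7_rep_def)
    have 6: "space_at L V6 = {0}"
      using source[of A5] 5 by (simp add: e7_rep_def)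
    have 2: "space_at L V2 = {0}"
      using target[of A2] 3 surj by (simp add: e7_rep_def)
    have 1: "space_at L V1 = {0}"
      using target[of A1] 2 surj by (simp add: e7_rep_def)
    have 7: "space_at L V7 = {0}"
      using target[of A6] 3 surj by (simp add: e7_rep_def)
    show ?thesis
      using 1 2 3 4 5 6 7 all_e7_vertex[of "\<lambda>i. space_at L i = {0}"]
      by (simp add: seq.nonzero_rep_def)
  qed
  show False
    using branch[OF dec] zero[OF dec] zero[OF seq.decomposes_commute[OF dec]] nz by blast
qed

text \<open>
  The vertex \<open>d\<close> carries the distinguished line of the plane at \<open>V3\<close>, and \<open>j\<close> the first of the two
  quotient lines. The maps along the paths from \<open>d\<close> to \<open>V3\<close> and from \<open>V3\<close> to \<open>j\<close> enter only through
  their compatibility with subrepresentations. A summand that contains the distinguished line is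
  nonzero on both quotient lines, hence the other one is zero there; since a vector of the plane
  with two vanishing projections is zero, the other summand is zero at \<open>V3\<close>.
\<close>

lemma plane_dichotomy:
  fixes M :: "'k::field e7_rep"
  assumes dec: "seq.decomposes E7 M N L"
    and spaces: "space_at M V3 = plane" "space_at M d = diagonal"
      "space_at M j = coord_line 0" "space_at M V7 = coord_line 1"
    and paths: "\<And>N. seq.subrep E7 N M \<Longrightarrow> space_at N d \<subseteq> space_at N V3"
      "\<And>N. seq.subrep E7 N M \<Longrightarrow> coord_part 0 ` space_at N V3 \<subseteq> space_at N j"
      "\<And>N. seq.subrep E7 N M \<Longrightarrow> coord_part 1 ` space_at N V3 \<subseteq> space_at N V7"
  shows "space_at N V3 = {0} \<or> space_at L V3 = {0}"
proof -
  have main: "space_at L V3 = {0}"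
    if dec: "seq.decomposes E7 M N L" and d: "space_at L d = {0}" for N L
  proof -
    have N: "seq.subrep E7 N M" and L: "seq.subrep E7 L M"
      using dec by (auto simp: seq.decomposes_def)
    let ?u = "unit_seq 0 + unit_seq 1 :: nat \<Rightarrow> 'k"
    have "?u \<in> diagonal"
      by (auto simp: mem_diagonal unit_seq_def)
    then have u: "?u \<in> space_at N V3"
      using seq.decomposes_complement[OF dec d] spaces paths(1)[OF N] by auto
    have nz: "coord_part 0 ?u \<noteq> 0" "coord_part 1 ?u \<noteq> 0"
      by (auto simp: coord_part_apply unit_seq_def fun_eq_iff)
    have "space_at L j = {0}"
      using seq.line_dichotomy[OF dec, of j "unit_seq 0"] spaces u paths(2)[OF N] nz
      by (auto simp: coord_line_def)
    moreover have "space_at L V7 = {0}"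
      using seq.line_dichotomy[OF dec, of V7 "unit_seq 1"] spaces u paths(3)[OF N] nz
      by (auto simp: coord_line_def)
    ultimately have killed: "coord_part 0 x = 0" "coord_part 1 x = 0" if "x \<in> space_at L V3" for x
      using paths(2,3)[OF L] that by auto
    have "x = 0" if x: "x \<in> space_at L V3" for x
    proof
      fix k :: nat
      consider "k = 0" | "k = 1" | "k \<ge> 2" by linarith
      then show "x k = 0 k"
        using killed[OF x] seq.subrep_subset[OF L, of V3] x spaces(1)
        by cases (auto simp: mem_plane coord_part_eq_0)
    qed
    then show ?thesis
      using seq.subspace_0[OF seq.subrep_subspace[OF L]] by blast
  qed
  have "space_at N d = {0} \<or> space_at L d = {0}"
    using seq.line_dichotomy[OF dec] spaces(2) unfolding diagonal_def by blast
  then show ?thesis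
    using main[OF dec] main[OF seq.decomposes_commute[OF dec]] by blast
qed

lemma subrep_e7_rep_paths:
  assumes "seq.subrep E7 N (e7_rep g h S1 S2 S3 S4 S5 S6 S7)"
  shows "space_at N V4 \<subseteq> space_at N V3" "space_at N V5 \<subseteq> space_at N V3"
    "space_at N V6 \<subseteq> space_at N V3"
    "h ` space_at N V3 \<subseteq> space_at N V2"
    "g ` space_at N V2 \<subseteq> space_at N V1"
    "coord_part 1 ` space_at N V3 \<subseteq> space_at N V7"
proof -
  note arrow = seq.subrep_arrow[OF assms]
  show 4: "space_at N V4 \<subseteq> space_at N V3"
    using arrow[of _ A3] by (auto simp: e7_rep_def)
  show 5: "space_at N V5 \<subseteq> space_at N V3"
    using arrow[of _ A4] 4 by (auto simp: e7_rep_def)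
  show "space_at N V6 \<subseteq> space_at N V3"
    using arrow[of _ A5] 5 by (auto simp: e7_rep_def)
  show "h ` space_at N V3 \<subseteq> space_at N V2"
    using arrow[of _ A2] by (auto simp: e7_rep_def)
  show "g ` space_at N V2 \<subseteq> space_at N V1"
    using arrow[of _ A1] by (auto simp: e7_rep_def)
  show "coord_part 1 ` space_at N V3 \<subseteq> space_at N V7"
    using arrow[of _ A6] by (auto simp: e7_rep_def)
qed

section \<open>The five indecomposable representations\<close>

lemmas fd_e7_rep_simps = seq.fd_representation_def e7_rep_def all_e7_vertex all_e7_arrow
  linear_between_coord_part linear_between_zero linear_between_id fin_dim_spaces
  mem_spaces coord_part_apply coord_part_eq_0

lemma coord_part_onto_line: "coord_line n \<subseteq> coord_part n ` S" if "coord_line n \<subseteq> S"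
proof
  fix x :: "nat \<Rightarrow> 'a" assume x: "x \<in> coord_line n"
  then have "x = coord_part n x"
    by (auto simp: mem_coord_line coord_part_apply fun_eq_iff)
  then show "x \<in> coord_part n ` S"
    using x that by blast
qed

lemma subset_plane: "coord_line 0 \<subseteq> plane" "coord_line 1 \<subseteq> plane" "diagonal \<subseteq> plane"
  by (auto simp: mem_spaces)

lemma zero_in_coord_part_image: "0 \<in> S \<Longrightarrow> 0 \<in> coord_part n ` S"
  by (rule image_eqI[of _ _ 0]) (simp_all add: coord_part_eq_0)

lemma zero_in_zero_image: "0 \<in> S \<Longrightarrow> 0 \<in> (\<lambda>_. 0) ` S"
  by blast

lemma zero_mem_spaces: "0 \<in> coord_line n" "0 \<in> diagonal" "0 \<in> plane"
  by (simp_all add: mem_spaces)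

lemmas onto_simps = coord_part_onto_line subset_plane zero_in_coord_part_image zero_in_zero_image
  zero_mem_spaces spaces_distinct

text \<open>
  The digits in the names of the following lemmas are the dimension vectors. In the first
  representation the projections map \<open>V3\<close> to the zero spaces at \<open>V2\<close> and \<open>V7\<close>, so its line has to be
  one that both of them kill.
\<close>

lemma indecomposable_0011000:
  "seq.indecomposable E7
     (e7_rep (coord_part 0) (coord_part 0) {0} {0} (coord_line 2) (coord_line 2) {0} {0} {0})"
proof (rule e7_rep_indecomposable)
  let ?M = "e7_rep (coord_part 0) (coord_part 0) {0} {0} (coord_line 2) (coord_line 2) {0} {0} {0}"
  show "seq.fd_representation E7 ?M"
    by (auto simp: fd_e7_rep_simps)
  fix N L assume "seq.decomposes E7 ?M N L"
  then show "space_at N V3 = {0} \<or> space_at L V3 = {0}"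
    using seq.line_dichotomy[of E7 ?M N L V3 "unit_seq 2"]
    by (simp add: e7_rep_def coord_line_def)
qed (simp_all add: onto_simps del: One_nat_def)

lemma indecomposable_0121001:
  "seq.indecomposable E7
     (e7_rep (\<lambda>_. 0) (coord_part 0) {0} (coord_line 0) plane diagonal {0} {0} (coord_line 1))"
proof (rule e7_rep_indecomposable)
  let ?M = "e7_rep (\<lambda>_. 0) (coord_part 0) {0} (coord_line 0) plane diagonal {0} {0} (coord_line 1)"
  show "seq.fd_representation E7 ?M"
    by (auto simp: fd_e7_rep_simps)
  fix N L assume "seq.decomposes E7 ?M N L"
  then show "space_at N V3 = {0} \<or> space_at L V3 = {0}"
    by (rule plane_dichotomy[where d = V4 and j = V2])
      (simp_all add: e7_rep_def subrep_e7_rep_paths[unfolded e7_rep_def] del: One_nat_def)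
qed (simp_all add: onto_simps del: One_nat_def)

lemma indecomposable_0122101:
  "seq.indecomposable E7
     (e7_rep (\<lambda>_. 0) (coord_part 0) {0} (coord_line 0) plane plane diagonal {0} (coord_line 1))"
proof (rule e7_rep_indecomposable)
  let ?M = "e7_rep (\<lambda>_. 0) (coord_part 0) {0} (coord_line 0) plane plane diagonal {0} (coord_line 1)"
  show "seq.fd_representation E7 ?M"
    by (auto simp: fd_e7_rep_simps)
  fix N L assume "seq.decomposes E7 ?M N L"
  then show "space_at N V3 = {0} \<or> space_at L V3 = {0}"
    by (rule plane_dichotomy[where d = V5 and j = V2])
      (simp_all add: e7_rep_def subrep_e7_rep_paths[unfolded e7_rep_def] del: One_nat_def)
qed (simp_all add: onto_simps del: One_nat_def)

lemma indecomposable_1221111: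
  "seq.indecomposable E7
     (e7_rep (coord_part 0) id (coord_line 0) plane plane diagonal diagonal diagonal (coord_line 1))"
proof (rule e7_rep_indecomposable)
  let ?M = "e7_rep (coord_part 0) id (coord_line 0) plane plane diagonal diagonal diagonal
    (coord_line 1)"
  show "seq.fd_representation E7 ?M"
    by (auto simp: fd_e7_rep_simps)
  fix N L assume dec: "seq.decomposes E7 ?M N L"
  have path: "coord_part 0 ` space_at N V3 \<subseteq> space_at N V1" if "seq.subrep E7 N ?M" for N
    using subrep_e7_rep_paths(4,5)[OF that] by auto
  show "space_at N V3 = {0} \<or> space_at L V3 = {0}"
    using dec
    by (rule plane_dichotomy[where d = V4 and j = V1])
      (simp_all add: path[unfolded e7_rep_def] e7_rep_def subrep_e7_rep_paths[unfolded e7_rep_def]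
        del: One_nat_def)
qed (simp_all add: onto_simps del: One_nat_def)

lemma indecomposable_1122211:
  "seq.indecomposable E7
     (e7_rep (coord_part 0) (coord_part 0) (coord_line 0) (coord_line 0) plane plane plane diagonal
       (coord_line 1))"
proof (rule e7_rep_indecomposable)
  let ?M = "e7_rep (coord_part 0) (coord_part 0) (coord_line 0) (coord_line 0) plane plane plane diagonal
    (coord_line 1)"
  show "seq.fd_representation E7 ?M"
    by (auto simp: fd_e7_rep_simps)
  fix N L assume "seq.decomposes E7 ?M N L"
  then show "space_at N V3 = {0} \<or> space_at L V3 = {0}"
    by (rule plane_dichotomy[where d = V6 and j = V2])
      (simp_all add: e7_rep_def subrep_e7_rep_paths[unfolded e7_rep_def] del: One_nat_def)
qed (simp_all add: onto_simps del: One_nat_def)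

section \<open>The contradictory slope inequalities\<close>

lemma additive_of_int_vec:
  fixes \<theta> :: "int ^ 'n \<Rightarrow> real"
  assumes "additive \<theta>"
  shows "\<theta> v = (\<Sum>i\<in>UNIV. of_int (v $ i) * \<theta> (axis i 1))"
proof -
  interpret additive \<theta> by fact
  have axis_nat: "\<theta> (axis i (int n)) = of_nat n * \<theta> (axis i 1)" for i n
  proof (induction n)
    case (Suc n)
    have "axis i (int (Suc n)) = axis i (int n) + axis i 1"
      by (simp add: axis_def vec_eq_iff)
    then show ?case
      using Suc by (simp add: add algebra_simps)
  qed (simp add: axis_def zero flip: zero_vec_def)
  have axis_int: "\<theta> (axis i k) = of_int k * \<theta> (axis i 1)" for i k
  proof (cases k)
    case (neg n)
    have "axis i k = - axis i (int (Suc n))"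
      by (simp add: neg axis_def vec_eq_iff)
    then show ?thesis
      using neg by (simp add: minus axis_nat del: of_nat_Suc)
  qed (simp add: axis_nat)
  have "v = (\<Sum>i\<in>UNIV. axis i (v $ i))"
    by (simp add: vec_eq_iff axis_def)
  then have "\<theta> v = \<theta> (\<Sum>i\<in>UNIV. axis i (v $ i))"
    by simp
  also have "\<dots> = (\<Sum>i\<in>UNIV. \<theta> (axis i (v $ i)))"
    by (rule sum)
  also have "\<dots> = (\<Sum>i\<in>UNIV. of_int (v $ i) * \<theta> (axis i 1))"
    by (intro sum.cong refl axis_int)
  finally show ?thesis .
qed

lemma additive_dim_vector_e7_rep:
  fixes \<theta> :: "int ^ e7_vertex \<Rightarrow> real"
  assumes "additive \<theta>"
  shows "\<theta> (seq.dim_vector (e7_rep g h S1 S2 S3 S4 S5 S6 S7)) =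
    seq.dim S1 * \<theta> (axis V1 1) + seq.dim S2 * \<theta> (axis V2 1) + seq.dim S3 * \<theta> (axis V3 1) +
    seq.dim S4 * \<theta> (axis V4 1) + seq.dim S5 * \<theta> (axis V5 1) + seq.dim S6 * \<theta> (axis V6 1) +
    seq.dim S7 * \<theta> (axis V7 1)"
  by (subst additive_of_int_vec[OF assms])
    (simp add: UNIV_e7_vertex seq.dim_vector_def e7_rep_def)

lemma total_dim_e7_rep:
  "seq.total_dim (e7_rep g h S1 S2 S3 S4 S5 S6 S7) =
    seq.dim S1 + seq.dim S2 + seq.dim S3 + seq.dim S4 + seq.dim S5 + seq.dim S6 + seq.dim S7"
  by (simp add: UNIV_e7_vertex seq.total_dim_def e7_rep_def)

text \<open>
  Each of the five subrepresentations is nonzero at \<open>V3\<close>, and smaller than the whole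
  representation at \<open>V3\<close> or, for the string of two lines, at \<open>V4\<close>.
\<close>

lemma total_stability_e7_rep:
  assumes "seq.total_stability E7 \<mu>"
    and "seq.indecomposable E7 (e7_rep g h S1 S2 S3 S4 S5 S6 S7)"
    and "seq.fd_representation E7 (e7_rep g h T1 T2 T3 T4 T5 T6 T7)"
    and "T1 \<subseteq> S1" "T2 \<subseteq> S2" "T3 \<subseteq> S3" "T4 \<subseteq> S4" "T5 \<subseteq> S5" "T6 \<subseteq> S6" "T7 \<subseteq> S7"
    and "T3 \<noteq> {0}" "T3 \<noteq> S3 \<or> T4 \<noteq> S4"
  shows "\<mu> (e7_rep g h T1 T2 T3 T4 T5 T6 T7) < \<mu> (e7_rep g h S1 S2 S3 S4 S5 S6 S7)"
proof -
  have "space_at (e7_rep g h T1 T2 T3 T4 T5 T6 T7) \<noteq> space_at (e7_rep g h S1 S2 S3 S4 S5 S6 S7)"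
    using \<open>T3 \<noteq> S3 \<or> T4 \<noteq> S4\<close>
    by (auto simp: e7_rep_def fun_eq_iff all_e7_vertex)
  moreover have "seq.nonzero_rep (e7_rep g h T1 T2 T3 T4 T5 T6 T7)"
    using \<open>T3 \<noteq> {0}\<close> by (rule nonzero_e7_rep)
  moreover have "seq.stable E7 \<mu> (e7_rep g h S1 S2 S3 S4 S5 S6 S7)"
    using assms(1,2) by (simp add: seq.total_stability_def)
  ultimately show ?thesis
    using subrep_e7_rep[OF assms(3-10)] by (simp add: seq.stable_def)
qed

theorem theorem1p2:
  "\<not> (\<exists>\<theta> :: int ^ e7_vertex \<Rightarrow> real. additive \<theta> \<and>
        seq.total_stability E7
          (\<lambda>M :: 'k::field e7_rep. \<theta> (seq.dim_vector M) / real (seq.total_dim M)))"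
proof
  assume "\<exists>\<theta> :: int ^ e7_vertex \<Rightarrow> real. additive \<theta> \<and>
        seq.total_stability E7
          (\<lambda>M :: 'k e7_rep. \<theta> (seq.dim_vector M) / real (seq.total_dim M))"
  then obtain \<theta> :: "int ^ e7_vertex \<Rightarrow> real" where add: "additive \<theta>" and
    stab: "seq.total_stability E7
      (\<lambda>M :: 'k e7_rep. \<theta> (seq.dim_vector M) / real (seq.total_dim M))"
    by blast
  note slope_less = total_stability_e7_rep[OF stab]
  define x where "x i = \<theta> (axis i 1)" for i
  note slope_simps = additive_dim_vector_e7_rep[OF add] total_dim_e7_rep dim_spaces x_def[symmetric]
  note inclusion_simps = subset_plane zero_mem_spaces spaces_distinct spaces_distinct[symmetric]
  have "seq.fd_representation E7
      (e7_rep (coord_part 0) (coord_part 0) {0} {0} (coord_line 2) {0} {0} {0} {0} :: 'k e7_rep)"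
    by (auto simp: fd_e7_rep_simps)
  from slope_less[OF indecomposable_0011000 this]
  have "x V3 < (x V3 + x V4) / 2"
    by (simp add: slope_simps inclusion_simps del: One_nat_def)
  then have 1: "0 < x V4 - x V3"
    by (simp add: field_simps)
  have "seq.fd_representation E7
      (e7_rep (\<lambda>_. 0) (coord_part 0) {0} (coord_line 0) (coord_line 0) {0} {0} {0} {0}
        :: 'k e7_rep)"
    by (auto simp: fd_e7_rep_simps)
  from slope_less[OF indecomposable_0121001 this]
  have "(x V2 + x V3) / 2 < (x V2 + 2 * x V3 + x V4 + x V7) / 5"
    by (simp add: slope_simps inclusion_simps del: One_nat_def)
  then have 2: "0 < - 3 * x V2 - x V3 + 2 * x V4 + 2 * x V7"
    by (simp add: field_simps)
  have "seq.fd_representation E7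
      (e7_rep (\<lambda>_. 0) (coord_part 0) {0} (coord_line 0) (coord_line 0) (coord_line 0) {0} {0} {0}
        :: 'k e7_rep)"
    by (auto simp: fd_e7_rep_simps)
  from slope_less[OF indecomposable_0122101 this]
  have "(x V2 + x V3 + x V4) / 3 < (x V2 + 2 * x V3 + 2 * x V4 + x V5 + x V7) / 7"
    by (simp add: slope_simps inclusion_simps del: One_nat_def)
  then have 3: "0 < - 4 * x V2 - x V3 - x V4 + 3 * x V5 + 3 * x V7"
    by (simp add: field_simps)
  have "seq.fd_representation E7
      (e7_rep (coord_part 0) id (coord_line 0) diagonal diagonal diagonal diagonal diagonal (coord_line 1)
        :: 'k e7_rep)"
    by (auto simp: fd_e7_rep_simps)
  from slope_less[OF indecomposable_1221111 this]
  have "(x V1 + x V2 + x V3 + x V4 + x V5 + x V6 + x V7) / 7 <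
      (x V1 + 2 * x V2 + 2 * x V3 + x V4 + x V5 + x V6 + x V7) / 9"
    by (simp add: slope_simps inclusion_simps del: One_nat_def)
  then have 4: "0 < - 2 * x V1 + 5 * x V2 + 5 * x V3 - 2 * x V4 - 2 * x V5 - 2 * x V6 - 2 * x V7"
    by (simp add: field_simps)
  have "seq.fd_representation E7
      (e7_rep (coord_part 0) (coord_part 0) {0} {0} (coord_line 1) (coord_line 1) (coord_line 1) {0}
        (coord_line 1) :: 'k e7_rep)"
    by (auto simp: fd_e7_rep_simps)
  from slope_less[OF indecomposable_1122211 this]
  have "(x V3 + x V4 + x V5 + x V7) / 4 <
      (x V1 + x V2 + 2 * x V3 + 2 * x V4 + 2 * x V5 + x V6 + x V7) / 10"
    by (simp add: slope_simps inclusion_simps del: One_nat_def)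
  then have 5: "0 < 2 * x V1 + 2 * x V2 - x V3 - x V4 - x V5 + 2 * x V6 - 3 * x V7"
    by (simp add: field_simps)
  \<comment> \<open>The combination with the coefficients \<open>2, 1, 1, 1, 1\<close> reads \<open>0 < 0\<close>.\<close>
  show False
    using 1 2 3 4 5 by linarith
qed

end
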